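(* Let $S$ be a Polish semigroup and let $\mu,\nu$ be Borel probability measures on $S$. Suppose $$\nu=\mu*\nu=\nu*\mu .$$ Then, for any $x\in\mathcal{S}(\mu)$ and any $a\in\mathcal{S}(\nu)$, it holds that $$\nu*\delta_{xa}=\nu*\delta_a,\qquad \delta_{ax}*\nu=\delta_a*\nu .$$
   Context: A Polish semigroup is a semigroup with a Polish (separable, completely metrizable) topology for which multiplication is jointly continuous. Convolution: $(\mu*\nu)(B)=\iint 1_B(xy)\,\mu(dx)\,\nu(dy)$ for Borel $B\subset S$. $\delta_a$ is the Dirac mass at $a$. The topological support $\mathcal{S}(\mu)$ is the set of $x\in S$ such that $\mu(U)>0$ for every open neighbourhood $U$ of $x$. *)

theory Defs
  imports "HOL-Probability.Giry_Monad"
begin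

text \<open>
  A Polish semigroup is a type of sort \<open>{polish_space, topological_semigroup_mult}\<close>:
  the class \<open>topological_semigroup_mult\<close> demands joint continuity of an associative
  multiplication. The class \<open>polish_space\<close> carries a chosen complete compatible metric,
  but only its topology and the induced Borel sets are used below.
\<close>

definition borel_prob_measure :: "'a::topological_space measure \<Rightarrow> bool" where
  "borel_prob_measure \<mu> \<longleftrightarrow> prob_space \<mu> \<and> sets \<mu> = sets borel"

definition semigroup_convolution ::
    "'a::{polish_space, topological_semigroup_mult} measure \<Rightarrow> 'a measure \<Rightarrow> 'a measure"
    (infixl \<open>\<circledast>\<close> 70) where
  "\<mu> \<circledast> \<nu> = measure_of UNIV (sets borel)
     (\<lambda>B. \<integral>\<^sup>+ x. (\<integral>\<^sup>+ y. indicator B (x * y) \<partial>\<nu>) \<partial>\<mu>)"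

definition topological_support :: "'a::topological_space measure \<Rightarrow> 'a set" where
  "topological_support \<mu> = {x. \<forall>U. open U \<and> x \<in> U \<longrightarrow> emeasure \<mu> U > 0}"

lemma borel_measurable_mult_pair:
  "(\<lambda>(x, y). x * y) \<in> borel \<Otimes>\<^sub>M borel \<rightarrow>\<^sub>M
     (borel :: 'a::{polish_space, topological_semigroup_mult} measure)"
proof -
  have "continuous_on UNIV (\<lambda>p::'a \<times> 'a. fst p * snd p)"
    unfolding continuous_on_def
    by (intro ballI tendsto_mult tendsto_fst tendsto_snd tendsto_ident_at)
  then have "(\<lambda>p::'a \<times> 'a. fst p * snd p) \<in> borel_measurable borel"
    by (rule borel_measurable_continuous_onI)
  then show ?thesis
    by (simp add: borel_prod case_prod_beta')
qed

text \<open>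
  \<open>measure_of\<close> returns a null measure unless its last argument is countably additive;
  the lemma \<open>emeasure_semigroup_convolution\<close> below shows that this
  never happens for Borel probability measures.
\<close>

lemma emeasure_distr_mult:
  fixes \<mu> \<nu> :: "'a::{polish_space, topological_semigroup_mult} measure"
  assumes "borel_prob_measure \<mu>" "borel_prob_measure \<nu>" and B: "B \<in> sets borel"
  shows "emeasure (distr (\<mu> \<Otimes>\<^sub>M \<nu>) borel (\<lambda>(x, y). x * y)) B
    = (\<integral>\<^sup>+ x. (\<integral>\<^sup>+ y. indicator B (x * y) \<partial>\<nu>) \<partial>\<mu>)"
    (is "emeasure ?D B = _")
proof -
  interpret N: prob_space \<nu>
    using assms by (simp add: borel_prob_measure_def)
  have s: "sets \<mu> = sets borel" "sets \<nu> = sets borel"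
    using assms by (auto simp: borel_prob_measure_def)
  have m: "(\<lambda>(x, y). x * y) \<in> \<mu> \<Otimes>\<^sub>M \<nu> \<rightarrow>\<^sub>M (borel :: 'a measure)"
    using borel_measurable_mult_pair measurable_cong_sets[OF sets_pair_measure_cong[OF s] refl]
    by blast
  have i: "(\<lambda>p. indicator B (case p of (x, y) \<Rightarrow> x * y) :: ennreal)
      \<in> borel_measurable (\<mu> \<Otimes>\<^sub>M \<nu>)"
    using measurable_compose[OF m borel_measurable_indicator[OF B]] .
  have "emeasure ?D B = (\<integral>\<^sup>+ z. indicator B z \<partial>?D)"
    using B by simp
  also have "\<dots> = (\<integral>\<^sup>+ p. indicator B (case p of (x, y) \<Rightarrow> x * y) \<partial>(\<mu> \<Otimes>\<^sub>M \<nu>))"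
    using B by (intro nn_integral_distr m) simp
  also have "\<dots> = (\<integral>\<^sup>+ x. (\<integral>\<^sup>+ y. indicator B (x * y) \<partial>\<nu>) \<partial>\<mu>)"
    using N.nn_integral_fst[OF i] by simp
  finally show ?thesis .
qed

lemma semigroup_convolution_eq_distr:
  fixes \<mu> \<nu> :: "'a::{polish_space, topological_semigroup_mult} measure"
  assumes "borel_prob_measure \<mu>" "borel_prob_measure \<nu>"
  shows "\<mu> \<circledast> \<nu> = distr (\<mu> \<Otimes>\<^sub>M \<nu>) borel (\<lambda>(x, y). x * y)"
    (is "_ = ?D")
proof -
  have "?D = measure_of (space ?D) (sets ?D) (emeasure ?D)"
    by (rule measure_of_of_measure[symmetric])
  also have "\<dots> = measure_of UNIV (sets borel) (emeasure ?D)"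
    by simp
  also have "\<dots> = \<mu> \<circledast> \<nu>"
    unfolding semigroup_convolution_def
    using emeasure_distr_mult[OF assms] sets.sigma_sets_eq[of "borel :: 'a measure"]
    by (intro measure_of_eq) auto
  finally show ?thesis by simp
qed

lemma emeasure_semigroup_convolution:
  fixes \<mu> \<nu> :: "'a::{polish_space, topological_semigroup_mult} measure"
  assumes "borel_prob_measure \<mu>" "borel_prob_measure \<nu>" "B \<in> sets borel"
  shows "emeasure (\<mu> \<circledast> \<nu>) B = (\<integral>\<^sup>+ x. (\<integral>\<^sup>+ y. indicator B (x * y) \<partial>\<nu>) \<partial>\<mu>)"
  using emeasure_distr_mult[OF assms] semigroup_convolution_eq_distr[OF assms(1,2)] by simp

end

theory Submission
  imports Defs
begin

text \<open>
  For bounded continuous \<open>f\<close> put \<open>g y = \<integral>f (z * y) \<nu>(dz)\<close>. From \<open>\<nu> = \<nu> \<circledast> \<mu>\<close> the function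
  \<open>g\<close> is harmonic, \<open>g y = \<integral>g (x * y) \<mu>(dx)\<close>, and from \<open>\<nu> = \<mu> \<circledast> \<nu>\<close> the integral of \<open>g\<^sup>2\<close> against
  \<open>\<nu>\<close> equals that of \<open>(g (x * y))\<^sup>2\<close> against \<open>\<mu> \<Otimes>\<^sub>M \<nu>\<close>. Expanding the square, the integral of
  \<open>(g (x * y) - g y)\<^sup>2\<close> vanishes, so by continuity \<open>g (x * y) = g y\<close> on the product of the
  supports. The other identity is the mirror image.
\<close>

section \<open>Finite Borel measures are determined by bounded continuous functions\<close>

text \<open>Closed sets form an intersection-stable generator of the Borel sets, and the indicator
  of a closed set is a pointwise limit of continuous functions with values in [0, 1]. Dominated
  convergence therefore carries the hypothesis over to the generator.\<close>

lemma finite_borel_measure_eqI: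
  fixes M N :: "'a::metric_space measure"
  assumes fin: "finite_measure M" "finite_measure N"
    and sets: "sets M = sets borel" "sets N = sets borel"
    and eq: "\<And>f :: 'a \<Rightarrow> real. continuous_on UNIV f \<Longrightarrow> (\<And>x. \<bar>f x\<bar> \<le> 1) \<Longrightarrow>
      (\<integral>x. f x \<partial>M) = (\<integral>x. f x \<partial>N)"
  shows "M = N"
proof -
  interpret M: finite_measure M by fact
  interpret N: finite_measure N by fact
  have closed_eq: "emeasure M C = emeasure N C" if C: "closed C" for C
  \<comment> \<open>The empty set is split off because \<open>infdist x {}\<close> is 0 by
    convention, so the approximants below would be constantly 1 there.\<close>
  proof (cases "C = {}")
    case False
    \<comment> \<open>A tent that is 1 on \<open>C\<close> and, for positive \<open>n\<close>,
      vanishes from distance 1/n onwards. Since \<open>C\<close> is closed, every point outside has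
      positive distance and is eventually cut off.\<close>
    define f where "f n x = max 0 (1 - real n * infdist x C)" for n x
    have cont: "continuous_on UNIV (f n)" for n
      unfolding f_def by (intro continuous_intros)
    have bound: "\<bar>f n x\<bar> \<le> 1" for n x
      by (simp add: f_def infdist_nonneg)
    have lim: "(\<lambda>n. f n x) \<longlonglongrightarrow> indicator C x" for x
    proof (cases "x \<in> C")
      case True
      then show ?thesis by (simp add: f_def)
    next
      case F: False
      then have pos: "infdist x C > 0"
        using infdist_pos_not_in_closed[OF C False] by auto
      obtain k :: nat where k: "real k * infdist x C > 1"
        using reals_Archimedean3[OF pos] by blast
      have "f n x = 0" if "n \<ge> k" for n
      proof -
        have "real k * infdist x C \<le> real n * infdist x C"
          using that pos by (intro mult_right_mono) auto
        with k show ?thesis by (simp add: f_def)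
      qed
      then have "eventually (\<lambda>n. f n x = 0) sequentially"
        by (auto simp: eventually_sequentially)
      then show ?thesis using F by (simp add: tendsto_eventually)
    qed
    have conv: "(\<lambda>n. \<integral>x. f n x \<partial>L) \<longlonglongrightarrow> measure L C"
      if "finite_measure L" and s: "sets L = sets borel" for L
    proof -
      interpret L: finite_measure L by fact
      have m: "f n \<in> borel_measurable L" for n
        using borel_measurable_continuous_onI[OF cont[of n]] s
        by (simp cong: measurable_cong_sets)
      have CL: "C \<in> sets L" using C s by auto
      have "(\<lambda>n. \<integral>x. f n x \<partial>L) \<longlonglongrightarrow> (\<integral>x. indicator C x \<partial>L)"
        using CL bound lim
        by (intro integral_dominated_convergence[where w = "\<lambda>_. 1"] m) auto
      then show ?thesis using CL by simp
    qed
    have "measure M C = measure N C"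
      using conv[OF fin(1) sets(1)] conv[OF fin(2) sets(2)] eq[OF cont bound]
      by (auto intro: LIMSEQ_unique)
    then show ?thesis by (simp add: M.emeasure_eq_measure N.emeasure_eq_measure)
  qed simp
  show ?thesis
  \<comment> \<open>\<open>UNIV\<close> is itself closed and has finite mass, so a constant sequence
    serves as the exhaustion.\<close>
  proof (rule measure_eqI_generator_eq[where E = "Collect closed" and \<Omega> = UNIV
        and A = "\<lambda>_. UNIV"])
    show "Int_stable (Collect closed)" by (auto simp: Int_stable_def)
    show "sets M = sigma_sets UNIV (Collect closed)"
      "sets N = sigma_sets UNIV (Collect closed)"
      using sets by (simp_all add: borel_eq_closed)
  qed (auto simp: closed_eq)
qed

section \<open>Bounded continuous harmonic functions on the supports\<close>

lemma continuous_on_mult_semigroup: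
  fixes f g :: "'b::topological_space \<Rightarrow> 'a::topological_semigroup_mult"
  assumes "continuous_on A f" "continuous_on A g"
  shows "continuous_on A (\<lambda>x. f x * g x)"
  using assms unfolding continuous_on_def by (auto intro: tendsto_mult)

text \<open>The variance of \<open>g (m x y)\<close> in \<open>x\<close> under \<mu> has integral
  zero over \<open>y\<close> under \<nu>: the mean is \<open>g y\<close> by harmonicity, and the
  second moments agree by \<open>inv\<close>. The map \<open>m\<close> is kept abstract so that both
  \<open>x * y\<close> and \<open>y * x\<close> can be substituted.\<close>

lemma harmonic_on_support:
  fixes \<mu> :: "'a::polish_space measure" and \<nu> :: "'b::polish_space measure"
    and m :: "'a \<Rightarrow> 'b \<Rightarrow> 'b" and g :: "'b \<Rightarrow> real"
  assumes \<mu>: "borel_prob_measure \<mu>" and \<nu>: "borel_prob_measure \<nu>"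
    and cont_m: "continuous_on UNIV (\<lambda>p. m (fst p) (snd p))"
    and inv: "distr (\<mu> \<Otimes>\<^sub>M \<nu>) borel (\<lambda>p. m (fst p) (snd p)) = \<nu>"
    and cont_g: "continuous_on UNIV g" and bound: "\<And>y. \<bar>g y\<bar> \<le> c"
    and harmonic: "\<And>y. (\<integral>x. g (m x y) \<partial>\<mu>) = g y"
    and x: "x \<in> topological_support \<mu>" and a: "a \<in> topological_support \<nu>"
  shows "g (m x a) = g a"
proof (rule ccontr)
  assume neq: "g (m x a) \<noteq> g a"
  interpret M: prob_space \<mu> using \<mu> by (simp add: borel_prob_measure_def)
  interpret N: prob_space \<nu> using \<nu> by (simp add: borel_prob_measure_def)
  interpret P: pair_prob_space \<mu> \<nu> ..
  have s [measurable_cong]: "sets \<mu> = sets borel" "sets \<nu> = sets borel"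
    using \<mu> \<nu> by (auto simp: borel_prob_measure_def)
  \<comment> \<open>By second countability the product of the Borel sigma-algebras is the Borel
    sigma-algebra of the product space, so continuity on pairs yields measurability for the product
    measure.\<close>
  have sP: "sets (\<mu> \<Otimes>\<^sub>M \<nu>) = sets borel"
    unfolding borel_prod[symmetric] by (rule sets_pair_measure_cong[OF s])
  let ?G = "\<lambda>p. g (m (fst p) (snd p))" and ?g = "\<lambda>p::'a \<times> 'b. g (snd p)"
  have cG: "continuous_on UNIV ?G"
    by (rule continuous_on_compose2[OF cont_g cont_m]) auto
  have cg: "continuous_on UNIV ?g"
    by (rule continuous_on_compose2[OF cont_g]) (auto intro: continuous_intros)
  have mg [measurable]: "g \<in> borel_measurable borel"
    by (rule borel_measurable_continuous_onI[OF cont_g])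
  have mm: "(\<lambda>p. m (fst p) (snd p)) \<in> \<mu> \<Otimes>\<^sub>M \<nu> \<rightarrow>\<^sub>M borel"
    using borel_measurable_continuous_onI[OF cont_m] sP by (simp cong: measurable_cong_sets)
  have mG [measurable]: "?G \<in> borel_measurable (\<mu> \<Otimes>\<^sub>M \<nu>)"
    using borel_measurable_continuous_onI[OF cG] sP by (simp cong: measurable_cong_sets)
  have prod_bound: "\<bar>g y * g z\<bar> \<le> c * c" for y z
    unfolding abs_mult using bound[of y] by (intro mult_mono bound) auto
  have int: "integrable (\<mu> \<Otimes>\<^sub>M \<nu>) (\<lambda>p. ?G p * ?G p)"
    "integrable (\<mu> \<Otimes>\<^sub>M \<nu>) (\<lambda>p. ?G p * ?g p)"
    "integrable (\<mu> \<Otimes>\<^sub>M \<nu>) (\<lambda>p. ?g p * ?g p)"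
    by (auto intro!: P.P.integrable_const_bound[where B = "c * c"] simp: prod_bound
        abs_le_D1[OF prod_bound])
  \<comment> \<open>\<open>?G\<close> is \<open>g\<close> composed with a map whose law is
    \<nu>.\<close>
  have "(\<integral>p. ?G p * ?G p \<partial>(\<mu> \<Otimes>\<^sub>M \<nu>))
      = (\<integral>y. g y * g y \<partial>(distr (\<mu> \<Otimes>\<^sub>M \<nu>) borel (\<lambda>p. m (fst p) (snd p))))"
    by (rule integral_distr[symmetric, OF mm]) simp
  then have 1: "(\<integral>p. ?G p * ?G p \<partial>(\<mu> \<Otimes>\<^sub>M \<nu>)) = (\<integral>y. g y * g y \<partial>\<nu>)"
    by (simp add: inv)
  \<comment> \<open>Fubini with \<open>x\<close> innermost: the factor \<open>g y\<close> comes out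
    and harmonicity evaluates the rest.\<close>
  have "(\<integral>p. ?G p * ?g p \<partial>(\<mu> \<Otimes>\<^sub>M \<nu>)) = (\<integral>y. (\<integral>x. g (m x y) * g y \<partial>\<mu>) \<partial>\<nu>)"
    using P.integral_snd[of "\<lambda>x y. g (m x y) * g y"] int(2) by (simp add: case_prod_beta')
  then have 2: "(\<integral>p. ?G p * ?g p \<partial>(\<mu> \<Otimes>\<^sub>M \<nu>)) = (\<integral>y. g y * g y \<partial>\<nu>)"
    by (simp add: harmonic)
  have 3: "(\<integral>p. ?g p * ?g p \<partial>(\<mu> \<Otimes>\<^sub>M \<nu>)) = (\<integral>y. g y * g y \<partial>\<nu>)"
    using P.integral_snd[of "\<lambda>x y. g y * g y"] int(3)
    by (simp add: case_prod_beta' M.prob_space)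
  have expand: "(?G p - ?g p)\<^sup>2 = ?G p * ?G p - 2 * (?G p * ?g p) + ?g p * ?g p" for p
    by (simp add: power2_eq_square algebra_simps)
  \<comment> \<open>The three integrals coincide and enter with coefficients 1, -2 and 1.\<close>
  have "(\<integral>p. (?G p - ?g p)\<^sup>2 \<partial>(\<mu> \<Otimes>\<^sub>M \<nu>)) = 0"
    unfolding expand using int by (simp add: 1 2 3)
  moreover have "integrable (\<mu> \<Otimes>\<^sub>M \<nu>) (\<lambda>p. (?G p - ?g p)\<^sup>2)"
    unfolding expand using int by simp
  ultimately have "AE p in \<mu> \<Otimes>\<^sub>M \<nu>. (?G p - ?g p)\<^sup>2 = 0"
    by (subst (asm) integral_nonneg_eq_0_iff_AE) auto
  then have ae: "AE p in \<mu> \<Otimes>\<^sub>M \<nu>. ?G p = ?g p" by simp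
  \<comment> \<open>Continuity upgrades the almost sure equality: a point of difference
    \<open>(x, a)\<close> would have an open box around it inside the null set, yet each side of
    that box has positive mass by the choice of \<open>x\<close> and \<open>a\<close>.\<close>
  have "open {p. ?G p \<noteq> ?g p}" by (rule open_Collect_neq[OF cG cg])
  then obtain U V where UV: "open U" "open V" "(x, a) \<in> U \<times> V"
      "U \<times> V \<subseteq> {p. ?G p \<noteq> ?g p}"
    using neq by (elim open_prod_elim[where x = "(x, a)"]) auto
  have UVs: "U \<in> sets \<mu>" "V \<in> sets \<nu>" using UV(1,2) s by auto
  have "AE p in \<mu> \<Otimes>\<^sub>M \<nu>. p \<notin> U \<times> V"
    using ae UV(4) by (auto elim!: eventually_mono)
  then have "emeasure (\<mu> \<Otimes>\<^sub>M \<nu>) (U \<times> V) = 0"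
    using UVs by (subst (asm) AE_iff_measurable[of "U \<times> V"])
      (auto simp: space_pair_measure dest: sets.sets_into_space)
  then have "emeasure \<mu> U * emeasure \<nu> V = 0"
    using UVs by (simp add: N.emeasure_pair_measure_Times)
  moreover have "emeasure \<mu> U > 0" "emeasure \<nu> V > 0"
    using x a UV by (auto simp: topological_support_def)
  ultimately show False by auto
qed

text \<open>Dominated convergence along sequences, with the constant \<open>c\<close> as integrable
  majorant. It provides the continuity of the averaged functions to which
  \<open>harmonic_on_support\<close> is applied.\<close>

lemma continuous_on_integral_parameter:
  fixes h :: "'a::{first_countable_topology, t2_space} \<Rightarrow> 'b \<Rightarrow> real"
  assumes "finite_measure M" and meas: "\<And>y. h y \<in> borel_measurable M"
    and cont: "\<And>z. continuous_on UNIV (\<lambda>y. h y z)" and bound: "\<And>y z. \<bar>h y z\<bar> \<le> c"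
  shows "continuous_on UNIV (\<lambda>y. \<integral>z. h y z \<partial>M)"
proof (rule continuous_on_sequentiallyI)
  interpret finite_measure M by fact
  fix Y y assume Y: "Y \<longlonglongrightarrow> (y::'a)"
  have lim: "(\<lambda>n. h (Y n) z) \<longlonglongrightarrow> h y z" for z
    using continuous_on_tendsto_compose[OF cont[of z] Y] by simp
  show "(\<lambda>n. \<integral>z. h (Y n) z \<partial>M) \<longlonglongrightarrow> (\<integral>z. h y z \<partial>M)"
    using lim bound meas
    by (intro integral_dominated_convergence[where w = "\<lambda>_. c"]) auto
qed

section \<open>Integration against convolutions and Dirac masses\<close>

context
  fixes \<mu> \<nu> :: "'a::{polish_space, topological_semigroup_mult} measure"
  assumes \<mu>: "borel_prob_measure \<mu>" and \<nu>: "borel_prob_measure \<nu>"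
begin

text \<open>Both orders of Fubini are recorded because the harmonic functions below always integrate
  \<nu> inside and \<mu> outside, while \<nu> is the left factor in one case and the right factor in
  the other.\<close>

lemma
  fixes f :: "'a \<Rightarrow> real"
  assumes f: "f \<in> borel_measurable borel" and bound: "\<And>x. \<bar>f x\<bar> \<le> c"
  shows integral_semigroup_convolution:
      "(\<integral>z. f z \<partial>(\<mu> \<circledast> \<nu>)) = (\<integral>x. (\<integral>y. f (x * y) \<partial>\<nu>) \<partial>\<mu>)" (is ?fst)
    and integral_semigroup_convolution_swap:
      "(\<integral>z. f z \<partial>(\<mu> \<circledast> \<nu>)) = (\<integral>y. (\<integral>x. f (x * y) \<partial>\<mu>) \<partial>\<nu>)" (is ?snd)
proof -
  interpret M: prob_space \<mu> using \<mu> by (simp add: borel_prob_measure_def)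
  interpret N: prob_space \<nu> using \<nu> by (simp add: borel_prob_measure_def)
  interpret P: pair_prob_space \<mu> \<nu> ..
  have s: "sets \<mu> = sets borel" "sets \<nu> = sets borel"
    using \<mu> \<nu> by (auto simp: borel_prob_measure_def)
  have m: "(\<lambda>(x, y). x * y) \<in> \<mu> \<Otimes>\<^sub>M \<nu> \<rightarrow>\<^sub>M (borel :: 'a measure)"
    using borel_measurable_mult_pair measurable_cong_sets[OF sets_pair_measure_cong[OF s] refl]
    by blast
  have eq: "(\<integral>z. f z \<partial>(\<mu> \<circledast> \<nu>)) = (\<integral>(x, y). f (x * y) \<partial>(\<mu> \<Otimes>\<^sub>M \<nu>))"
    using integral_distr[OF m f] semigroup_convolution_eq_distr[OF \<mu> \<nu>]
    by (simp add: case_prod_beta')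
  have int: "integrable (\<mu> \<Otimes>\<^sub>M \<nu>) (\<lambda>(x, y). f (x * y))"
    using measurable_compose[OF m f] bound
    by (intro P.P.integrable_const_bound[where B = c]) (auto simp: case_prod_beta')
  show ?fst ?snd
    unfolding eq using P.integral_fst'[OF int] P.integral_snd[OF int] by simp_all
qed

end

lemma borel_measurable_mult_left_right:
  fixes b :: "'a::{polish_space, topological_semigroup_mult}"
  shows "(\<lambda>z. z * b) \<in> borel_measurable borel" "(\<lambda>z. b * z) \<in> borel_measurable borel"
  by (intro borel_measurable_continuous_onI continuous_on_mult_semigroup continuous_intros)+

lemma borel_prob_measure_return: "borel_prob_measure (return borel b)"
  by (simp add: borel_prob_measure_def prob_space_return)

text \<open>Rewriting convolution with a Dirac mass as the image under a translation reduces the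
  theorem to equalities of image measures, which continuous functions can test.\<close>

lemma
  fixes \<nu> :: "'a::{polish_space, topological_semigroup_mult} measure"
  assumes \<nu>: "borel_prob_measure \<nu>"
  shows semigroup_convolution_return_right:
      "\<nu> \<circledast> return borel b = distr \<nu> borel (\<lambda>z. z * b)"
    and semigroup_convolution_return_left:
      "return borel b \<circledast> \<nu> = distr \<nu> borel (\<lambda>z. b * z)"
proof -
  have s: "sets \<nu> = sets borel" using \<nu> by (simp add: borel_prob_measure_def)
  interpret N: prob_space \<nu> using \<nu> by (simp add: borel_prob_measure_def)
  note meas = borel_measurable_mult_left_right[of b]
  have m: "(\<lambda>z. z * b) \<in> \<nu> \<rightarrow>\<^sub>M borel" "(\<lambda>z. b * z) \<in> \<nu> \<rightarrow>\<^sub>M borel"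
    using meas s by (simp_all cong: measurable_cong_sets)
  note conv = semigroup_convolution_eq_distr[OF \<nu> borel_prob_measure_return]
    semigroup_convolution_eq_distr[OF borel_prob_measure_return \<nu>]
  have ind: "(\<lambda>y. indicator B (x * y) :: ennreal) \<in> borel_measurable borel"
    if "B \<in> sets borel" for B and x :: 'a
    using that borel_measurable_mult_left_right(2)[of x] by measurable
  show "\<nu> \<circledast> return borel b = distr \<nu> borel (\<lambda>z. z * b)"
  proof (rule measure_eqI)
    show "sets (\<nu> \<circledast> return borel b) = sets (distr \<nu> borel (\<lambda>z. z * b))"
      by (simp add: conv)
    fix B assume "B \<in> sets (\<nu> \<circledast> return borel b)"
    then have B: "B \<in> sets borel" by (simp add: conv)
    have "emeasure (distr \<nu> borel (\<lambda>z. z * b)) B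
        = (\<integral>\<^sup>+ z. indicator B z \<partial>(distr \<nu> borel (\<lambda>z. z * b)))"
      using B by simp
    also have "\<dots> = (\<integral>\<^sup>+ z. indicator B (z * b) \<partial>\<nu>)"
      using B by (intro nn_integral_distr m) simp
    finally show "emeasure (\<nu> \<circledast> return borel b) B = emeasure (distr \<nu> borel (\<lambda>z. z * b)) B"
      by (simp add: emeasure_semigroup_convolution[OF \<nu> borel_prob_measure_return B]
          nn_integral_return ind[OF B])
  qed
  show "return borel b \<circledast> \<nu> = distr \<nu> borel (\<lambda>z. b * z)"
  proof (rule measure_eqI)
    show "sets (return borel b \<circledast> \<nu>) = sets (distr \<nu> borel (\<lambda>z. b * z))"
      by (simp add: conv)
    fix B assume "B \<in> sets (return borel b \<circledast> \<nu>)"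
    then have B: "B \<in> sets borel" by (simp add: conv)
    \<comment> \<open>Here the Dirac mass acts on the outer variable, so evaluation at
      \<open>b\<close> requires the inner integral to be measurable in \<open>x\<close>; joint
      measurability and Tonelli give this.\<close>
    have i: "(\<lambda>p. indicator B (fst p * snd p) :: ennreal) \<in> borel_measurable (borel \<Otimes>\<^sub>M \<nu>)"
      using measurable_compose[OF borel_measurable_mult_pair borel_measurable_indicator[OF B]]
        measurable_cong_sets[OF sets_pair_measure_cong[OF refl s, of borel] refl]
      by (auto simp: case_prod_beta')
    have "(\<lambda>x. \<integral>\<^sup>+ y. indicator B (x * y) \<partial>\<nu>) \<in> borel_measurable borel"
      using N.borel_measurable_nn_integral_fst[OF i] by simp
    then have "(\<integral>\<^sup>+ x. (\<integral>\<^sup>+ y. indicator B (x * y) \<partial>\<nu>) \<partial>return borel b)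
        = (\<integral>\<^sup>+ z. indicator B (b * z) \<partial>\<nu>)"
      by (simp add: nn_integral_return)
    also have "\<dots> = (\<integral>\<^sup>+ z. indicator B z \<partial>(distr \<nu> borel (\<lambda>z. b * z)))"
      using B by (intro nn_integral_distr[symmetric] m) simp
    finally show "emeasure (return borel b \<circledast> \<nu>) B = emeasure (distr \<nu> borel (\<lambda>z. b * z)) B"
      using B by (simp add: emeasure_semigroup_convolution[OF borel_prob_measure_return \<nu> B])
  qed
qed

section \<open>Invariance of translated integrals and the conclusion\<close>

text \<open>The averages of \<open>f (z * y)\<close> and \<open>f (y * z)\<close> over
  \<open>z\<close> under \<nu> are bounded, continuous and harmonic in \<open>y\<close>, for
  multiplication by \<open>x\<close> on the left and on the right respectively, so
  \<open>harmonic_on_support\<close> applies to each.\<close>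

lemma
  fixes \<mu> \<nu> :: "'a::{polish_space, topological_semigroup_mult} measure"
  assumes \<mu>: "borel_prob_measure \<mu>" and \<nu>: "borel_prob_measure \<nu>"
    and inv: "\<mu> \<circledast> \<nu> = \<nu>" "\<nu> \<circledast> \<mu> = \<nu>"
    and x: "x \<in> topological_support \<mu>" and a: "a \<in> topological_support \<nu>"
    and f: "continuous_on UNIV f" and bound: "\<And>z. \<bar>f z\<bar> \<le> (c::real)"
  shows integral_translate_right_eq: "(\<integral>z. f (z * (x * a)) \<partial>\<nu>) = (\<integral>z. f (z * a) \<partial>\<nu>)"
    and integral_translate_left_eq: "(\<integral>z. f (a * x * z) \<partial>\<nu>) = (\<integral>z. f (a * z) \<partial>\<nu>)"
proof -
  interpret M: prob_space \<mu> using \<mu> by (simp add: borel_prob_measure_def)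
  interpret N: prob_space \<nu> using \<nu> by (simp add: borel_prob_measure_def)
  have s: "sets \<mu> = sets borel" "sets \<nu> = sets borel"
    using \<mu> \<nu> by (auto simp: borel_prob_measure_def)
  have cR: "continuous_on UNIV (\<lambda>z. f (z * y))" and cL: "continuous_on UNIV (\<lambda>z. f (y * z))" for y
    by (auto intro!: continuous_on_compose2[OF f] continuous_on_mult_semigroup
        continuous_intros)
  have mR: "(\<lambda>z. f (z * y)) \<in> borel_measurable borel"
    and mL: "(\<lambda>z. f (y * z)) \<in> borel_measurable borel" for y
    using cR cL by (auto intro: borel_measurable_continuous_onI)
  have mR': "(\<lambda>z. f (z * y)) \<in> borel_measurable \<nu>"
    and mL': "(\<lambda>z. f (y * z)) \<in> borel_measurable \<nu>" for y
    using mR[of y] mL[of y] s by (simp_all cong: measurable_cong_sets)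
  have int_bound: "\<bar>\<integral>z. f (h z) \<partial>\<nu>\<bar> \<le> c" if "(\<lambda>z. f (h z)) \<in> borel_measurable \<nu>" for h
  proof -
    have "integrable \<nu> (\<lambda>z. f (h z))"
      using that bound by (intro N.integrable_const_bound[where B = c]) auto
    moreover have "f z \<le> c" "- c \<le> f z" for z
      using bound[of z] by (auto simp: abs_le_iff)
    ultimately show ?thesis
      using N.integral_le_const[of "\<lambda>z. f (h z)" c] N.integral_ge_const[of "\<lambda>z. f (h z)" "- c"]
      by (simp add: abs_le_iff)
  qed
  \<comment> \<open>\<open>harmonic_on_support\<close> puts \<mu> first, so the mirrored case needs
    the law of \<nu> \<circledast> \<mu> with the coordinates swapped. The two invariance hypotheses
    thus exchange roles: \<open>inv(2)\<close> gives the invariant law here and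
    \<open>inv(1)\<close> the harmonicity.\<close>
  have distr_flip: "distr (\<mu> \<Otimes>\<^sub>M \<nu>) borel (\<lambda>p. snd p * fst p) = \<nu>"
  proof -
    have m: "(\<lambda>(x, y). x * y) \<in> \<nu> \<Otimes>\<^sub>M \<mu> \<rightarrow>\<^sub>M (borel :: 'a measure)"
      using borel_measurable_mult_pair
        measurable_cong_sets[OF sets_pair_measure_cong[OF s(2) s(1)] refl] by blast
    interpret Q: pair_prob_space \<nu> \<mu> ..
    have "\<nu> = distr (distr (\<mu> \<Otimes>\<^sub>M \<nu>) (\<nu> \<Otimes>\<^sub>M \<mu>) (\<lambda>(x, y). (y, x))) borel (\<lambda>(x, y). x * y)"
      using semigroup_convolution_eq_distr[OF \<nu> \<mu>] Q.distr_pair_swap inv(2) by simp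
    also have "\<dots> = distr (\<mu> \<Otimes>\<^sub>M \<nu>) borel (\<lambda>p. snd p * fst p)"
      by (subst distr_distr[OF m measurable_pair_swap']) (simp add: o_def case_prod_beta')
    finally show ?thesis by simp
  qed
  show "(\<integral>z. f (z * (x * a)) \<partial>\<nu>) = (\<integral>z. f (z * a) \<partial>\<nu>)"
  proof (rule harmonic_on_support[OF \<mu> \<nu> _ _ _ _ _ x a, where m = "(*)" and c = c])
    show "continuous_on UNIV (\<lambda>p::'a \<times> 'a. fst p * snd p)"
      by (intro continuous_on_mult_semigroup continuous_intros)
    show "distr (\<mu> \<Otimes>\<^sub>M \<nu>) borel (\<lambda>p. fst p * snd p) = \<nu>"
      using semigroup_convolution_eq_distr[OF \<mu> \<nu>] inv(1) by (simp add: case_prod_beta')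
    \<comment> \<open>Measurability concerns \<open>z\<close> and continuity concerns
      \<open>y\<close>, hence the pairing of \<open>mR'\<close> with \<open>cL\<close>.\<close>
    show "continuous_on UNIV (\<lambda>y. \<integral>z. f (z * y) \<partial>\<nu>)"
      by (intro continuous_on_integral_parameter[where c = c] N.finite_measure_axioms
          mR' cL bound)
    show "\<bar>\<integral>z. f (z * y) \<partial>\<nu>\<bar> \<le> c" for y
      by (rule int_bound[OF mR'])
    \<comment> \<open>By associativity the double integral tests \<nu> \<circledast> \<mu> on the
      function sending \<open>w\<close> to \<open>f (w * y)\<close>, and that convolution is
      \<nu>.\<close>
    show "(\<integral>x. (\<integral>z. f (z * (x * y)) \<partial>\<nu>) \<partial>\<mu>) = (\<integral>z. f (z * y) \<partial>\<nu>)" for y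
      using integral_semigroup_convolution_swap[OF \<nu> \<mu> mR[of y] bound]
      by (simp add: inv(2) mult.assoc)
  qed
  show "(\<integral>z. f (a * x * z) \<partial>\<nu>) = (\<integral>z. f (a * z) \<partial>\<nu>)"
  proof (rule harmonic_on_support[OF \<mu> \<nu> _ _ _ _ _ x a, where m = "\<lambda>x y. y * x" and c = c])
    show "continuous_on UNIV (\<lambda>p::'a \<times> 'a. snd p * fst p)"
      by (intro continuous_on_mult_semigroup continuous_intros)
    show "distr (\<mu> \<Otimes>\<^sub>M \<nu>) borel (\<lambda>p. snd p * fst p) = \<nu>" by (rule distr_flip)
    show "continuous_on UNIV (\<lambda>y. \<integral>z. f (y * z) \<partial>\<nu>)"
      by (intro continuous_on_integral_parameter[where c = c] N.finite_measure_axioms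
          mL' cR bound)
    show "\<bar>\<integral>z. f (y * z) \<partial>\<nu>\<bar> \<le> c" for y
      by (rule int_bound[OF mL'])
    \<comment> \<open>Likewise, \<open>f (y * (x * z))\<close> tests \<mu> \<circledast> \<nu> on
      the function sending \<open>w\<close> to \<open>f (y * w)\<close>.\<close>
    show "(\<integral>x. (\<integral>z. f (y * x * z) \<partial>\<nu>) \<partial>\<mu>) = (\<integral>z. f (y * z) \<partial>\<nu>)" for y
      using integral_semigroup_convolution[OF \<mu> \<nu> mL[of y] bound]
      by (simp add: inv(1) mult.assoc)
  qed
qed

theorem proposition4p5:
  fixes \<mu> \<nu> :: "'a::{polish_space, topological_semigroup_mult} measure"
    and x a :: 'a
  assumes "borel_prob_measure \<mu>" and "borel_prob_measure \<nu>"
    and "\<nu> = \<mu> \<circledast> \<nu>" and "\<nu> = \<nu> \<circledast> \<mu>"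
    and "x \<in> topological_support \<mu>" and "a \<in> topological_support \<nu>"
  shows "\<nu> \<circledast> return borel (x * a) = \<nu> \<circledast> return borel a
       \<and> return borel (a * x) \<circledast> \<nu> = return borel a \<circledast> \<nu>"
proof -
  interpret N: prob_space \<nu> using assms(2) by (simp add: borel_prob_measure_def)
  have s: "sets \<nu> = sets borel" using assms(2) by (simp add: borel_prob_measure_def)
  have m: "(\<lambda>z. z * b) \<in> \<nu> \<rightarrow>\<^sub>M borel" "(\<lambda>z. b * z) \<in> \<nu> \<rightarrow>\<^sub>M borel" for b :: 'a
    using borel_measurable_mult_left_right[of b] s by (simp_all cong: measurable_cong_sets)
  note translate = integral_translate_right_eq[OF assms(1,2) assms(3,4)[symmetric] assms(5,6)]
    integral_translate_left_eq[OF assms(1,2) assms(3,4)[symmetric] assms(5,6)]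
  \<comment> \<open>The test functions of \<open>finite_borel_measure_eqI\<close> are bounded by 1,
    which fixes \<open>c = 1\<close>.\<close>
  have "distr \<nu> borel (\<lambda>z. z * (x * a)) = distr \<nu> borel (\<lambda>z. z * a)"
    by (rule finite_borel_measure_eqI)
      (simp_all add: N.finite_measure_distr m integral_distr borel_measurable_continuous_onI
        translate[where c = 1])
  moreover have "distr \<nu> borel (\<lambda>z. a * x * z) = distr \<nu> borel (\<lambda>z. a * z)"
    by (rule finite_borel_measure_eqI)
      (simp_all add: N.finite_measure_distr m integral_distr borel_measurable_continuous_onI
        translate[where c = 1])
  ultimately show ?thesis
    by (simp add: semigroup_convolution_return_right[OF assms(2)]
        semigroup_convolution_return_left[OF assms(2)])
qed

end
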